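(* Let $\varepsilon>0$ and let $W_0$ denote the principal branch of the Lambert $W$ function. For any two nondegenerate $n$-dimensional Gaussian distributions $\mathcal{N}(\bm\mu_1,\bm\Sigma_1)$ and $\mathcal{N}(\bm\mu_2,\bm\Sigma_2)$ (any $n\ge1$), if $KL(\mathcal{N}(\bm\mu_1,\bm\Sigma_1)\,\|\,\mathcal{N}(\bm\mu_2,\bm\Sigma_2))\le\varepsilon$, then $$KL(\mathcal{N}(\bm\mu_2,\bm\Sigma_2)\,\|\,\mathcal{N}(\bm\mu_1,\bm\Sigma_1))\le \frac12\left\{\frac{1}{-W_0(-e^{-(1+2\varepsilon)})}-\log\frac{1}{-W_0(-e^{-(1+2\varepsilon)})}-1\right\}.$$
   Context: $KL(p\|q)=\int p\log(p/q)$ is the Kullback–Leibler divergence. The Lambert $W$ function is the (multivalued) inverse of $y=xe^x$; on real arguments in $[-1/e,0)$ it has two real branches: the principal branch $W_0$ (values in $[-1,0)$) and the branch $W_{-1}$ (values in $(-\infty,-1]$). *)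

theory Defs
  imports "HOL-Analysis.Analysis"
begin

text \<open>Principal branch W_0 of the Lambert W function on [-1/e, infinity):
  the unique w with w \<ge> -1 and w * exp w = x.\<close>
definition LambertW0 :: "real \<Rightarrow> real" where
  "LambertW0 x = (THE w. -1 \<le> w \<and> w * exp w = x)"

definition pos_def_cov :: "real^'n^'n \<Rightarrow> bool" where
  "pos_def_cov S \<longleftrightarrow> transpose S = S \<and> (\<forall>x. x \<noteq> 0 \<longrightarrow> x \<bullet> (S *v x) > 0)"

definition gauss_density :: "real^'n \<Rightarrow> real^'n^'n \<Rightarrow> real^'n \<Rightarrow> real" where
  "gauss_density mu S x =
     exp (- ((x - mu) \<bullet> (matrix_inv S *v (x - mu))) / 2)
       / sqrt ((2 * pi) ^ CARD('n) * det S)"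

definition KL_dens :: "(real^'n \<Rightarrow> real) \<Rightarrow> (real^'n \<Rightarrow> real) \<Rightarrow> real" where
  "KL_dens p q = (\<integral>x. p x * ln (p x / q x) \<partial>lborel)"

definition KL_gauss :: "real^'n \<Rightarrow> real^'n^'n \<Rightarrow> real^'n \<Rightarrow> real^'n^'n \<Rightarrow> real" where
  "KL_gauss mu1 S1 mu2 S2 = KL_dens (gauss_density mu1 S1) (gauss_density mu2 S2)"

end

theory Submission
  imports Defs "HOL-Probability.Distributions"
begin

text \<open>
  Let \<open>f(a) = a - 1 - ln a\<close>. Simultaneous diagonalization of the two precision matrices by a
  congruence turns the first Gaussian into the standard one and the second into one with mean
  \<open>m\<close> and precisions \<open>a\<^sub>i\<close>, so that twice the two divergences are \<open>\<Sum> f(a\<^sub>i) + a\<^sub>i m\<^sub>i\<^sup>2\<close> and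
  \<open>\<Sum> f(1/a\<^sub>i) + m\<^sub>i\<^sup>2\<close>. Let \<open>w < 1\<close> be the small solution of \<open>f(w) = 2\<epsilon>\<close>; then
  \<open>-w = W\<^sub>0(-exp(-(1 + 2\<epsilon>)))\<close>. The chord estimate
  \<open>f(1/a) + M \<le> f(1/w) / f(w) \<cdot> (f(a) + a M)\<close>, valid whenever \<open>f(a) + a M \<le> f(w)\<close>,
  is summed over the coordinates.
\<close>

section \<open>Linear change of variables\<close>

lemma Basis_cart: "Basis = range (\<lambda>i. axis i (1::real))"
  by (auto simp: Basis_vec_def)

lemma inj_axis_1: "inj (\<lambda>i. axis i (1::real))"
  by (auto simp: inj_def axis_eq_axis)

text \<open>Integrate coordinate \<open>m\<close> first. Since \<open>m \<noteq> n\<close>, the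
  shear only translates this coordinate by the fixed number \<open>x $ n\<close>, and Lebesgue
  measure on the line is translation invariant.\<close>

lemma nn_integral_lborel_shear:
  fixes f :: "real^'n \<Rightarrow> ennreal" and m n :: 'n
  assumes [measurable]: "f \<in> borel_measurable borel" and "m \<noteq> n"
  shows "(\<integral>\<^sup>+x. f (x + (x $ n) *\<^sub>R axis m 1) \<partial>lborel) = (\<integral>\<^sup>+x. f x \<partial>lborel)"
proof -
  interpret product_sigma_finite "\<lambda>_::real^'n. lborel :: real measure" ..
  let ?e = "axis m 1 :: real^'n"
  let ?I = "Basis - {?e}"
  let ?v = "\<lambda>g :: real^'n \<Rightarrow> real. \<Sum>b\<in>?I. g b *\<^sub>R b"
  have e: "?e \<in> Basis" by (simp add: axis_in_Basis_iff)
  have B: "Basis = insert ?e ?I" using e by auto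
  have fubini: "(\<integral>\<^sup>+x. h x \<partial>lborel) =
      (\<integral>\<^sup>+g. (\<integral>\<^sup>+t. h (t *\<^sub>R ?e + ?v g) \<partial>lborel) \<partial>(Pi\<^sub>M ?I (\<lambda>_. lborel)))"
    if [measurable]: "h \<in> borel_measurable borel" for h :: "real^'n \<Rightarrow> ennreal"
  proof -
    have "(\<integral>\<^sup>+x. h x \<partial>lborel) = (\<integral>\<^sup>+g. h (\<Sum>b\<in>Basis. g b *\<^sub>R b) \<partial>(Pi\<^sub>M Basis (\<lambda>_. lborel)))"
      by (subst lborel_eq, subst nn_integral_distr) auto
    also have "\<dots> = (\<integral>\<^sup>+g. h (\<Sum>b\<in>Basis. g b *\<^sub>R b) \<partial>(Pi\<^sub>M (insert ?e ?I) (\<lambda>_. lborel)))"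
      using B by simp
    also have "\<dots> = (\<integral>\<^sup>+g. (\<integral>\<^sup>+t. h (\<Sum>b\<in>Basis. (g(?e := t)) b *\<^sub>R b) \<partial>lborel) \<partial>(Pi\<^sub>M ?I (\<lambda>_. lborel)))"
    proof (rule product_nn_integral_insert)
      show "(\<lambda>g. h (\<Sum>b\<in>Basis. g b *\<^sub>R b)) \<in> borel_measurable (Pi\<^sub>M (insert ?e ?I) (\<lambda>_. lborel))"
        by (subst B[symmetric]) measurable
    qed auto
    also have "(\<lambda>g t. \<Sum>b\<in>Basis. (g(?e := t)) b *\<^sub>R b) = (\<lambda>g t. t *\<^sub>R ?e + ?v g)"
    proof (intro ext)
      fix g :: "real^'n \<Rightarrow> real" and t
      have "(\<Sum>b\<in>Basis. (g(?e := t)) b *\<^sub>R b) = t *\<^sub>R ?e + (\<Sum>b\<in>?I. (g(?e := t)) b *\<^sub>R b)"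
        using e by (subst sum.remove[of _ ?e]) auto
      then show "(\<Sum>b\<in>Basis. (g(?e := t)) b *\<^sub>R b) = t *\<^sub>R ?e + ?v g" by simp
    qed
    then have "(\<integral>\<^sup>+g. (\<integral>\<^sup>+t. h (\<Sum>b\<in>Basis. (g(?e := t)) b *\<^sub>R b) \<partial>lborel) \<partial>(Pi\<^sub>M ?I (\<lambda>_. lborel)))
       = (\<integral>\<^sup>+g. (\<integral>\<^sup>+t. h (t *\<^sub>R ?e + ?v g) \<partial>lborel) \<partial>(Pi\<^sub>M ?I (\<lambda>_. lborel)))"
      by (simp add: fun_eq_iff)
    finally show ?thesis .
  qed
  have "(\<integral>\<^sup>+t. f ((t *\<^sub>R ?e + ?v g) + ((t *\<^sub>R ?e + ?v g) $ n) *\<^sub>R ?e) \<partial>lborel)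
      = (\<integral>\<^sup>+t. f (t *\<^sub>R ?e + ?v g) \<partial>lborel)" for g
  proof -
    have "(\<integral>\<^sup>+t. f (t *\<^sub>R ?e + ?v g) \<partial>lborel)
        = (\<integral>\<^sup>+t. f ((?v g $ n + t) *\<^sub>R ?e + ?v g) \<partial>lborel)"
      by (subst nn_integral_real_affine[where c = 1 and t = "?v g $ n"]) auto
    moreover have "(t *\<^sub>R ?e + ?v g) + ((t *\<^sub>R ?e + ?v g) $ n) *\<^sub>R ?e = (?v g $ n + t) *\<^sub>R ?e + ?v g" for t
      using \<open>m \<noteq> n\<close> by (simp add: axis_def algebra_simps)
    ultimately show ?thesis by (simp only:)
  qed
  then show ?thesis
    by (subst (1 2) fubini) (auto intro!: borel_measurable_continuous_onI continuous_intros)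
qed

text \<open>Lebesgue measure is determined by its values on boxes, and permuting coordinates sends a
  box to one with the same side lengths.\<close>

lemma nn_integral_lborel_permute:
  fixes f :: "real^'n \<Rightarrow> ennreal" and \<pi> :: "'n \<Rightarrow> 'n"
  assumes [measurable]: "f \<in> borel_measurable borel" and "bij \<pi>"
  shows "(\<integral>\<^sup>+x. f (\<chi> i. x $ \<pi> i) \<partial>lborel) = (\<integral>\<^sup>+x. f x \<partial>lborel)"
proof -
  let ?h = "\<lambda>x :: real^'n. \<chi> i. x $ \<pi> i"
  have [measurable]: "?h \<in> borel_measurable borel"
    by (intro borel_measurable_continuous_onI continuous_intros)
  have perm: "(lborel :: (real^'n) measure) = distr lborel borel ?h"
  proof (rule lborel_eqI)
    fix l u :: "real^'n" assume le: "\<And>b. b \<in> Basis \<Longrightarrow> l \<bullet> b \<le> u \<bullet> b"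
    \<comment> \<open>\<open>p\<close> is the inverse of \<open>?h\<close>; it carries the corners
      of a box to those of its preimage.\<close>
    define p where "p x = (\<chi> i. x $ inv \<pi> i)" for x :: "real^'n"
    have [simp]: "\<pi> (inv \<pi> i) = i" "inv \<pi> (\<pi> i) = i" for i
      using \<open>bij \<pi>\<close> by (simp_all add: bij_is_inj bij_is_surj surj_f_inv_f)
    have "?h -` box l u = box (p l) (p u)"
      by (auto simp: mem_box_cart p_def) (metis \<open>\<And>i. \<pi> (inv \<pi> i) = i\<close> | metis \<open>\<And>i. inv \<pi> (\<pi> i) = i\<close>)+
    moreover have "l $ i \<le> u $ i" for i
      using le[of "axis i 1"] by (simp add: inner_axis axis_in_Basis_iff)
    moreover have "(\<Prod>b\<in>Basis. (p u - p l) \<bullet> b) = (\<Prod>b\<in>Basis. (u - l) \<bullet> b)"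
    proof -
      have prod_Basis: "(\<Prod>b\<in>Basis. x \<bullet> b) = (\<Prod>i\<in>UNIV. x $ i)" for x :: "real^'n"
        by (simp add: Basis_cart prod.reindex[OF inj_axis_1] inner_axis)
      show ?thesis unfolding prod_Basis
        using \<open>bij \<pi>\<close> by (intro prod.reindex_bij_witness[of _ \<pi> "inv \<pi>"]) (auto simp: p_def)
    qed
    ultimately show "emeasure (distr lborel borel ?h) (box l u) = (\<Prod>b\<in>Basis. (u - l) \<bullet> b)"
      by (auto simp: emeasure_distr emeasure_lborel_box_eq inner_axis Basis_vec_def p_def)
  qed simp
  have "(\<integral>\<^sup>+x. f x \<partial>lborel) = (\<integral>\<^sup>+x. f x \<partial>distr lborel borel ?h)"
    by (rule arg_cong[OF perm])
  also have "\<dots> = (\<integral>\<^sup>+x. f (?h x) \<partial>lborel)"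
    by (rule nn_integral_distr) auto
  finally show ?thesis ..
qed

text \<open>The change of variables theorems of the library need a well-ordered index type.\<close>
lemma nn_integral_lborel_linear:
  fixes A :: "real^'n^'n" and f :: "real^'n \<Rightarrow> ennreal"
  assumes "det A \<noteq> 0" and "f \<in> borel_measurable borel"
  shows "(\<integral>\<^sup>+x. f x \<partial>lborel) = ennreal \<bar>det A\<bar> * (\<integral>\<^sup>+x. f (A *v x) \<partial>lborel)"
proof -
  \<comment> \<open>The claim is proved by induction over products of elementary matrices. It
    quantifies over \<open>f\<close> because the product case applies it to
    \<open>\<lambda>x. f (A *v x)\<close>; the determinant guard makes the zero-row case
    vacuous.\<close>
  define P where "P A \<longleftrightarrow> det A \<noteq> 0 \<longrightarrow> (\<forall>f\<in>borel_measurable borel.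
    (\<integral>\<^sup>+x. f x \<partial>lborel) = ennreal \<bar>det A\<bar> * (\<integral>\<^sup>+x. f (A *v x) \<partial>lborel))" for A :: "real^'n^'n"
  have mv[measurable]: "(*v) A \<in> borel_measurable borel" for A :: "real^'n^'n"
    by (intro borel_measurable_continuous_onI matrix_vector_mult_linear_continuous_on)
  have "P A"
  proof (rule induct_matrix_elementary_alt)
    fix A B assume AB: "P A" "P B"
    show "P (A ** B)"
      unfolding P_def
    proof (intro impI ballI)
      fix f :: "real^'n \<Rightarrow> ennreal" assume det: "det (A ** B) \<noteq> 0" and [measurable]: "f \<in> borel_measurable borel"
      have fA: "(\<lambda>x. f (A *v x)) \<in> borel_measurable borel"
        by measurable
      have dets: "det A \<noteq> 0" "det B \<noteq> 0"
        using det by (auto simp: det_mul)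
      have "(\<integral>\<^sup>+x. f x \<partial>lborel) = ennreal \<bar>det A\<bar> * (\<integral>\<^sup>+x. f (A *v x) \<partial>lborel)"
        using AB(1) dets \<open>f \<in> _\<close> by (metis P_def)
      also have "(\<integral>\<^sup>+x. f (A *v x) \<partial>lborel) = ennreal \<bar>det B\<bar> * (\<integral>\<^sup>+x. f (A *v (B *v x)) \<partial>lborel)"
        using AB(2)[unfolded P_def, rule_format, OF dets(2), of "\<lambda>x. f (A *v x)"] fA by (simp only:)
      finally show "(\<integral>\<^sup>+x. f x \<partial>lborel) = ennreal \<bar>det (A ** B)\<bar> * (\<integral>\<^sup>+x. f (A ** B *v x) \<partial>lborel)"
        by (simp add: det_mul abs_mult ennreal_mult mult.assoc matrix_vector_mul_assoc)
    qed
  next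
    fix A :: "real^'n^'n" and i assume "row i A = 0"
    then show "P A" unfolding P_def using det_zero_row(2) by auto
  next
    fix A :: "real^'n^'n" assume diag: "\<And>i j. i \<noteq> j \<Longrightarrow> A $ i $ j = 0"
    show "P A"
      unfolding P_def
    proof (intro impI ballI)
      fix f :: "real^'n \<Rightarrow> ennreal" assume det: "det A \<noteq> 0" and [measurable]: "f \<in> borel_measurable borel"
      \<comment> \<open>These are the diagonal entries, indexed by basis vectors as
        \<open>lborel_affine_euclidean\<close> requires.\<close>
      define c where "c b = b \<bullet> (A *v b)" for b :: "real^'n"
      have Ac: "A $ i $ i = c (axis i 1)" for i
        by (simp add: c_def inner_axis' matrix_vector_mult_basis column_def)
      have detA: "det A = (\<Prod>j\<in>Basis. c j)"
        by (simp add: det_diagonal[OF diag] Basis_cart prod.reindex[OF inj_axis_1] Ac)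
      have A: "A *v x = 0 + (\<Sum>j\<in>Basis. (c j * (x \<bullet> j)) *\<^sub>R j)" for x
      proof -
        have "(\<Sum>j\<in>UNIV. A $ i $ j * x $ j) = A $ i $ i * x $ i" for i
          using diag by (subst sum.remove[of _ i]) auto
        moreover have "(\<Sum>j\<in>Basis. (c j * (x \<bullet> j)) *\<^sub>R j) $ i = A $ i $ i * x $ i" for i
          using inner_sum_left_Basis[of "axis i 1" "\<lambda>j. c j * (x \<bullet> j)"] Ac[of i]
          by (simp add: inner_axis axis_in_Basis_iff)
        ultimately show ?thesis
          by (simp add: vec_eq_iff matrix_vector_mult_def)
      qed
      have prod_c: "ennreal \<bar>det A\<bar> = (\<Prod>j\<in>Basis. \<bar>c j\<bar>)"
        by (simp add: detA abs_prod)
      have lb: "(lborel :: (real^'n) measure) = density (distr lborel borel ((*v) A)) (\<lambda>_. \<bar>det A\<bar>)"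
        unfolding A[abs_def] prod_c by (rule lborel_affine_euclidean) (use det detA in auto)
      show "(\<integral>\<^sup>+x. f x \<partial>lborel) = ennreal \<bar>det A\<bar> * (\<integral>\<^sup>+x. f (A *v x) \<partial>lborel)"
        by (subst lb) (simp add: nn_integral_density nn_integral_distr nn_integral_cmult)
    qed
  next
    fix m n :: 'n assume mn: "m \<noteq> n"
    let ?A = "\<chi> i j. mat 1 $ i $ Transposition.transpose m n j :: real^'n^'n"
    have "\<bar>det ?A\<bar> = 1"
      by (simp add: det_permute_columns permutes_swap_id sign_swap_id mn abs_mult)
    moreover have "?A *v x = (\<chi> i. x $ Transposition.transpose m n i)" for x :: "real^'n"
    proof -
      have "i = Transposition.transpose m n j \<longleftrightarrow> Transposition.transpose m n i = j" for i j
        by (metis transpose_involutory)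
      then show ?thesis
        by (simp add: vec_eq_iff matrix_vector_mult_def mat_def if_distrib[of "\<lambda>u. u * v" for v] cong: if_cong)
    qed
    ultimately show "P ?A"
      unfolding P_def by (auto simp: nn_integral_lborel_permute)
  next
    fix m n :: 'n assume mn: "m \<noteq> n"
    let ?A = "\<chi> i j. of_bool (i = m \<and> j = n \<or> i = j) :: real^'n^'n"
    have "?A = (\<chi> k. if k = m then row m (mat 1) + 1 *s row n (mat 1) else row k (mat 1))"
      using mn by (auto simp: vec_eq_iff row_def mat_def)
    then have "det ?A = 1"
      by (simp only: det_row_operation[OF mn] det_I)
    moreover have "?A *v x = x + (x $ n) *\<^sub>R axis m 1" for x :: "real^'n"
    proof -
      have "(\<Sum>j\<in>UNIV. of_bool (i = m \<and> j = n \<or> i = j) * x $ j) = x $ i + (if i = m then x $ n else 0)" for i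
        using mn by (subst sum.remove[of _ i]) (auto simp: of_bool_def if_distrib[of "\<lambda>u. u * v" for v] cong: if_cong)
      then show ?thesis
        by (auto simp: vec_eq_iff matrix_vector_mult_def axis_def)
    qed
    ultimately show "P ?A"
      unfolding P_def by (auto simp: nn_integral_lborel_shear mn)
  qed
  then show ?thesis using assms unfolding P_def by blast
qed


text \<open>Testing the linear change of variables on indicators, after a translation, gives an
  equality of measures, which then also transfers Bochner integrals of real functions.\<close>

lemma lborel_affine_matrix:
  fixes A :: "real^'n^'n" and t :: "real^'n"
  assumes "det A \<noteq> 0"
  shows "lborel = density (distr lborel borel (\<lambda>x. t + A *v x)) (\<lambda>_. ennreal \<bar>det A\<bar>)"
proof (rule measure_eqI)
  have [measurable]: "(\<lambda>x. t + A *v x) \<in> borel_measurable borel"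
    by (intro borel_measurable_continuous_onI continuous_intros matrix_vector_mult_linear_continuous_on)
  fix X :: "(real^'n) set" assume "X \<in> sets lborel"
  then have [measurable]: "X \<in> sets borel" by simp
  have "emeasure lborel X = emeasure (distr lborel borel ((+) t)) X"
    by (simp only: lborel_distr_plus)
  also have "\<dots> = (\<integral>\<^sup>+x. indicator X (t + x) \<partial>lborel)"
    using nn_integral_distr[of "(+) t" lborel borel "indicator X"] by simp
  also have "\<dots> = ennreal \<bar>det A\<bar> * (\<integral>\<^sup>+x. indicator X (t + A *v x) \<partial>lborel)"
    by (rule nn_integral_lborel_linear[OF assms]) measurable
  also have "\<dots> = (\<integral>\<^sup>+x. ennreal \<bar>det A\<bar> * indicator X x \<partial>(distr lborel borel (\<lambda>x. t + A *v x)))"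
    by (simp add: nn_integral_distr nn_integral_cmult del: nn_integral_indicator)
  also have "\<dots> = emeasure (density (distr lborel borel (\<lambda>x. t + A *v x)) (\<lambda>_. ennreal \<bar>det A\<bar>)) X"
    by (subst emeasure_density) auto
  finally show "emeasure lborel X = emeasure (density (distr lborel borel (\<lambda>x. t + A *v x)) (\<lambda>_. ennreal \<bar>det A\<bar>)) X" .
qed simp

lemma integral_lborel_affine_matrix:
  fixes A :: "real^'n^'n" and t :: "real^'n" and f :: "real^'n \<Rightarrow> real"
  assumes "det A \<noteq> 0" and [measurable]: "f \<in> borel_measurable borel"
  shows "(\<integral>x. f x \<partial>lborel) = (\<integral>x. \<bar>det A\<bar> * f (t + A *v x) \<partial>lborel)"
proof -
  have [measurable]: "(\<lambda>x. t + A *v x) \<in> borel_measurable borel"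
    by (intro borel_measurable_continuous_onI continuous_intros matrix_vector_mult_linear_continuous_on)
  show ?thesis
    by (subst lborel_affine_matrix[OF assms(1), of t])
       (simp add: integral_density integral_distr)
qed

section \<open>Gaussian moments\<close>

lemma has_bochner_integral_lborel_prod_cart:
  fixes f :: "'n::finite \<Rightarrow> real \<Rightarrow> real"
  assumes f: "\<And>i. has_bochner_integral lborel (f i) (c i)"
  shows "has_bochner_integral lborel (\<lambda>x::real^'n. \<Prod>i\<in>UNIV. f i (x $ i)) (\<Prod>i\<in>UNIV. c i)"
proof -
  interpret product_sigma_finite "\<lambda>_::real^'n. lborel :: real measure" ..
  \<comment> \<open>\<open>lborel\<close> on vectors is an image of a product measure indexed by
    \<open>Basis\<close>; \<open>idx\<close> recovers the coordinate index from a basis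
    vector.\<close>
  define idx where "idx = inv (\<lambda>i::'n. axis i (1::real))"
  have [simp]: "idx (axis i 1) = i" for i
    unfolding idx_def by (rule inv_f_f[OF inj_axis_1])
  let ?F = "\<lambda>g. \<Prod>b\<in>Basis. f (idx b) (g b)"
  have meas[measurable]: "f i \<in> borel_measurable borel" for i
    using f[of i] by (auto dest: borel_measurable_has_bochner_integral)
  have int: "integrable lborel (f i)" "integral\<^sup>L lborel (f i) = c i" for i
    using f[of i] by (auto simp: has_bochner_integral_iff)
  have F: "(\<Prod>i\<in>UNIV. f i ((\<Sum>b\<in>Basis. g b *\<^sub>R b) $ i)) = ?F g" for g :: "real^'n \<Rightarrow> real"
  proof -
    have "(\<Sum>b\<in>Basis. g b *\<^sub>R b) $ i = g (axis i 1)" for i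
      using inner_sum_left_Basis[of "axis i 1" g] by (simp add: inner_axis axis_in_Basis_iff)
    then show ?thesis by (simp add: Basis_cart prod.reindex[OF inj_axis_1])
  qed
  have "has_bochner_integral (Pi\<^sub>M Basis (\<lambda>_. lborel)) ?F (\<Prod>b\<in>Basis. c (idx b))"
    using product_integrable_prod[of Basis "\<lambda>b. f (idx b)"] product_integral_prod[of Basis "\<lambda>b. f (idx b)"] int
    by (simp add: has_bochner_integral_iff)
  moreover have "(\<Prod>b\<in>Basis. c (idx b)) = (\<Prod>i\<in>UNIV. c i)"
    by (simp add: Basis_cart prod.reindex[OF inj_axis_1])
  ultimately show ?thesis
    by (subst lborel_eq, subst has_bochner_integral_distr) (auto simp: F simp del: sum_component)
qed

text \<open>All factors except the one for coordinate \<open>k\<close> are probability densities and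
  integrate to 1.\<close>

lemma has_bochner_integral_std_normal_marginal:
  fixes g :: "real \<Rightarrow> real" and k :: "'n::finite"
  assumes "has_bochner_integral lborel (\<lambda>t. std_normal_density t * g t) c"
  shows "has_bochner_integral lborel (\<lambda>x::real^'n. (\<Prod>i\<in>UNIV. std_normal_density (x $ i)) * g (x $ k)) c"
proof -
  define f where "f i = (\<lambda>t. std_normal_density t * (if i = k then g t else 1))" for i
  have norm: "has_bochner_integral lborel std_normal_density 1"
    by (simp add: has_bochner_integral_iff)
  have "has_bochner_integral lborel (\<lambda>x::real^'n. \<Prod>i\<in>UNIV. f i (x $ i)) (\<Prod>i\<in>UNIV. if i = k then c else 1)"
    using assms norm by (intro has_bochner_integral_lborel_prod_cart) (auto simp: f_def)
  then show ?thesis by (simp add: f_def prod.distrib)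
qed

text \<open>The standard normal law has mass 1, mean 0 and second moment 1.\<close>

lemma has_bochner_integral_std_normal_quadratic:
  "has_bochner_integral lborel (\<lambda>t. std_normal_density t * (\<alpha> * t\<^sup>2 + \<beta> * t + \<gamma>)) (\<alpha> + \<gamma>)"
proof -
  have "has_bochner_integral lborel
      (\<lambda>t. \<alpha> * (std_normal_density t * t\<^sup>2) + \<beta> * (std_normal_density t * t) + \<gamma> * std_normal_density t)
      (\<alpha> * 1 + \<beta> * 0 + \<gamma> * 1)"
  proof (intro has_bochner_integral_add has_bochner_integral_mult_right)
    show "has_bochner_integral lborel (\<lambda>t. std_normal_density t * t\<^sup>2) 1"
      using std_normal_moment_even[of 1] by (simp add: fact_numeral)
    show "has_bochner_integral lborel (\<lambda>t. std_normal_density t * t) 0"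
      using std_normal_moment_odd[of 0] by simp
    show "has_bochner_integral lborel std_normal_density 1"
      by (simp add: has_bochner_integral_iff)
  qed
  then show ?thesis by (simp add: algebra_simps)
qed

section \<open>Simultaneous diagonalization\<close>

lemma symmetric_matrix_inner:
  fixes P :: "real^'n^'n"
  assumes "transpose P = P"
  shows "x \<bullet> (P *v y) = y \<bullet> (P *v x)"
  by (metis assms dot_lmul_matrix inner_commute transpose_matrix_vector)

lemma pos_def_cov_imp_invertible:
  assumes "pos_def_cov S"
  shows "invertible S"
proof -
  have "x = 0" if "S *v x = 0" for x
    using assms that unfolding pos_def_cov_def by (metis inner_zero_right less_irrefl)
  then show ?thesis
    using matrix_left_invertible_ker invertible_left_inverse by blast
qed

lemma matrix_inv_mult:
  fixes S :: "real^'n^'n"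
  assumes "invertible S"
  shows "S ** matrix_inv S = mat 1" "matrix_inv S ** S = mat 1"
  using someI_ex[OF assms[unfolded invertible_def]] unfolding matrix_inv_def by auto

text \<open>Substituting \<open>x = S *v y\<close> turns the form of the inverse at \<open>x\<close>
  into the form of \<open>S\<close> at \<open>y\<close>.\<close>

lemma pos_def_cov_matrix_inv:
  fixes S :: "real^'n^'n"
  assumes "pos_def_cov S"
  shows "pos_def_cov (matrix_inv S)"
  unfolding pos_def_cov_def
proof (intro conjI allI impI)
  note inv = matrix_inv_mult[OF pos_def_cov_imp_invertible[OF assms]]
  have sym: "transpose S = S" and pos: "x \<noteq> 0 \<Longrightarrow> 0 < x \<bullet> (S *v x)" for x
    using assms by (auto simp: pos_def_cov_def)
  have "transpose (matrix_inv S) ** S = mat 1"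
    by (metis inv(1) matrix_transpose_mul sym transpose_mat)
  then show "transpose (matrix_inv S) = matrix_inv S"
    by (metis inv(1) matrix_mul_assoc matrix_mul_lid matrix_mul_rid)
  fix x :: "real^'n" assume "x \<noteq> 0"
  define y where "y = matrix_inv S *v x"
  have x: "x = S *v y" by (simp add: y_def matrix_vector_mul_assoc inv)
  with \<open>x \<noteq> 0\<close> have "y \<noteq> 0" by auto
  then show "0 < x \<bullet> (matrix_inv S *v x)"
    using pos[of y] by (simp add: x matrix_vector_mul_assoc inv inner_commute)
qed

text \<open>The next vector maximises the Rayleigh quotient of \<open>Q\<close> relative to \<open>P\<close> on the
  \<open>P\<close>-orthogonal complement of the previous ones.\<close>
lemma partial_simultaneous_diagonalization:
  fixes P Q :: "real^'n^'n" and I :: "'n set"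
  assumes P: "pos_def_cov P" and Q: "transpose Q = Q"
  shows "\<exists>v a. (\<forall>i\<in>I. \<forall>j\<in>I. v i \<bullet> (P *v v j) = of_bool (i = j)) \<and> (\<forall>i\<in>I. Q *v v i = a i *\<^sub>R (P *v v i))"
  using finite[of I]
proof (induction I rule: finite_induct)
  case empty
  show ?case by simp
next
  case (insert k I)
  then obtain v a where orth: "\<And>i j. i \<in> I \<Longrightarrow> j \<in> I \<Longrightarrow> v i \<bullet> (P *v v j) = of_bool (i = j)"
    and eig: "\<And>i. i \<in> I \<Longrightarrow> Q *v v i = a i *\<^sub>R (P *v v i)" by blast
  have Psym: "x \<bullet> (P *v y) = y \<bullet> (P *v x)" and Qsym: "x \<bullet> (Q *v y) = y \<bullet> (Q *v x)" for x y
    using P Q symmetric_matrix_inner by (auto simp: pos_def_cov_def)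
  have Ppos: "0 < x \<bullet> (P *v x)" if "x \<noteq> 0" for x
    using P that by (auto simp: pos_def_cov_def)
  define W where "W = {x. \<forall>i\<in>I. x \<bullet> (P *v v i) = 0}"
  have W_add: "x + c *\<^sub>R y \<in> W" if "x \<in> W" "y \<in> W" for x y c
    using that by (simp add: W_def inner_add_left)
  \<comment> \<open>Fewer vectors than the dimension have been chosen, so their
    \<open>P\<close>-orthogonal complement \<open>W\<close> contains a nonzero vector.\<close>
  have "card I < CARD('n)"
    using insert.hyps by (metis UNIV_I finite psubsetI psubset_card_mono subset_UNIV)
  then have "dim ((\<lambda>i. P *v v i) ` I) < DIM(real^'n)"
    using dim_le_card'[of "(\<lambda>i. P *v v i) ` I"] card_image_le[OF insert.hyps(1), of "\<lambda>i. P *v v i"] insert.hyps(1) by simp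
  then obtain x0 where "x0 \<noteq> 0" and "\<And>y. y \<in> span ((\<lambda>i. P *v v i) ` I) \<Longrightarrow> orthogonal x0 y"
    using orthogonal_to_subspace_exists by blast
  then have x0: "x0 \<noteq> 0" "x0 \<in> W"
    by (auto simp: W_def orthogonal_def span_base)
  \<comment> \<open>The Rayleigh quotient is invariant under scaling, so a maximum on this compact
    set is a maximum over all nonzero vectors of \<open>W\<close>.\<close>
  define K where "K = W \<inter> sphere 0 1"
  define R where "R x = (x \<bullet> (Q *v x)) / (x \<bullet> (P *v x))" for x
  have "closed W"
    unfolding W_def Collect_ball_eq by (intro closed_INT ballI closed_Collect_eq continuous_intros)
  then have "compact K"
    unfolding K_def by (simp add: closed_Int_compact)
  moreover have scale: "x /\<^sub>R norm x \<in> K" if "x \<in> W" "x \<noteq> 0" for x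
    using that by (simp add: K_def W_def)
  then have "K \<noteq> {}" using x0 by blast
  moreover have "continuous_on K R"
    unfolding R_def
  proof (intro continuous_intros matrix_vector_mult_linear_continuous_on)
    have "x \<noteq> 0" if "x \<in> K" for x using that by (auto simp: K_def)
    then show "\<forall>x\<in>K. x \<bullet> (P *v x) \<noteq> 0" using Ppos by (metis less_irrefl)
  qed
  ultimately obtain u where u: "u \<in> K" "\<And>x. x \<in> K \<Longrightarrow> R x \<le> R u"
    using continuous_attains_sup by meson
  have uW: "u \<in> W" and "u \<noteq> 0" using u by (auto simp: K_def)
  have up: "0 < u \<bullet> (P *v u)" using Ppos[OF \<open>u \<noteq> 0\<close>] .
  \<comment> \<open>Maximality of \<open>u\<close> says that this symmetric form is nonnegative on
    \<open>W\<close> and vanishes at \<open>u\<close>. Hence \<open>u\<close> is in its radical on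
    \<open>W\<close>, which is the eigenvector equation tested against \<open>W\<close>.\<close>
  define B where "B x y = R u * (x \<bullet> (P *v y)) - x \<bullet> (Q *v y)" for x y
  have Bsym: "B x y = B y x" for x y
    unfolding B_def using Psym Qsym by metis
  have Buu: "B u u = 0" using up by (simp add: B_def R_def)
  have Bnn: "0 \<le> B x x" if "x \<in> W" for x
  proof (cases "x = 0")
    case False
    have "R (x /\<^sub>R norm x) = R x"
      using False by (simp add: R_def matrix_vector_mult_scaleR)
    then have "R x \<le> R u" using u(2)[OF scale[OF that False]] by simp
    then show ?thesis using Ppos[OF False] by (simp add: B_def R_def field_simps)
  qed (simp add: B_def)
  have Buy: "B u y = 0" if y: "y \<in> W" for y
  proof (rule ccontr)
    assume ne: "B u y \<noteq> 0"
    \<comment> \<open>The value \<open>t = - B u y / B y y\<close> would minimise the form along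
      \<open>u + t *\<^sub>R y\<close>. Adding 1 keeps the denominator positive when
      \<open>B y y = 0\<close> and still yields a negative value.\<close>
    define d where "d = B y y + 1"
    have d: "0 < d" using Bnn[OF y] by (simp add: d_def)
    define t where "t = - B u y / d"
    have "B (u + t *\<^sub>R y) (u + t *\<^sub>R y) = B u u + t * B u y + t * B y u + t\<^sup>2 * B y y"
      by (simp add: B_def inner_add_left inner_add_right matrix_vector_right_distrib
          matrix_vector_mult_scaleR power2_eq_square algebra_simps)
    also have "\<dots> = 2 * t * B u y + t\<^sup>2 * B y y"
      by (simp add: Buu Bsym[of y u])
    also have "\<dots> = - (B u y)\<^sup>2 * (d + 1) / d\<^sup>2"
    proof -
      have "B y y = d - 1" by (simp add: d_def)
      then show ?thesis
        unfolding t_def using d by (simp only:) (simp add: field_simps power2_eq_square)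
    qed
    also have "\<dots> < 0" using ne d by (simp add: divide_neg_pos)
    finally show False using Bnn[OF W_add[OF uW y]] by (simp add: not_less[symmetric])
  qed
  \<comment> \<open>The residual of the eigenvector equation is orthogonal to \<open>W\<close> by
    the previous step and to each \<open>v i\<close> because \<open>v i\<close> already satisfies
    its own equation. These vectors span the space.\<close>
  define g where "g = R u *\<^sub>R (P *v u) - Q *v u"
  have Bg: "B u x = g \<bullet> x" for x
    unfolding Bsym[of u x] by (simp add: B_def g_def inner_commute[of _ x] inner_diff_right)
  have "g \<bullet> x = 0" for x
  proof -
    \<comment> \<open>This is the \<open>P\<close>-orthogonal projection of \<open>x\<close> onto
      \<open>W\<close>.\<close>
    define y where "y = x - (\<Sum>i\<in>I. (x \<bullet> (P *v v i)) *\<^sub>R v i)"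
    have "y \<bullet> (P *v v j) = 0" if j: "j \<in> I" for j
    proof -
      have "(\<Sum>i\<in>I. (x \<bullet> (P *v v i)) * (v i \<bullet> (P *v v j))) = (\<Sum>i\<in>I. if i = j then x \<bullet> (P *v v j) else 0)"
        by (intro sum.cong) (auto simp: orth j)
      then show ?thesis
        using j insert.hyps(1) by (simp add: y_def inner_diff_left inner_sum_left)
    qed
    then have "y \<in> W" by (simp add: W_def)
    have "g \<bullet> v i = 0" if "i \<in> I" for i
      using uW that eig[OF that] by (simp add: Bg[symmetric] B_def W_def)
    moreover have "g \<bullet> x = g \<bullet> y + (\<Sum>i\<in>I. (x \<bullet> (P *v v i)) * (g \<bullet> v i))"
      by (simp add: y_def inner_diff_right inner_sum_right)
    ultimately show ?thesis using Buy[OF \<open>y \<in> W\<close>] by (simp add: Bg)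
  qed
  then have "g = 0" by (metis inner_eq_zero_iff)
  then have Qu: "Q *v u = R u *\<^sub>R (P *v u)" by (simp add: g_def)
  define s where "s = 1 / sqrt (u \<bullet> (P *v u))"
  have s: "s * s * (u \<bullet> (P *v u)) = 1" using up by (simp add: s_def)
  define v' where "v' = v(k := s *\<^sub>R u)"
  define a' where "a' = a(k := R u)"
  have uv: "u \<bullet> (P *v v i) = 0" "v i \<bullet> (P *v u) = 0" if "i \<in> I" for i
    using uW that Psym[of "v i" u] by (auto simp: W_def)
  have "\<forall>i\<in>insert k I. \<forall>j\<in>insert k I. v' i \<bullet> (P *v v' j) = of_bool (i = j)"
    using insert.hyps(2) orth uv s
    by (auto simp: v'_def matrix_vector_mult_scaleR)
  moreover have "\<forall>i\<in>insert k I. Q *v v' i = a' i *\<^sub>R (P *v v' i)"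
    using insert.hyps(2) eig Qu by (auto simp: v'_def a'_def matrix_vector_mult_scaleR)
  ultimately show ?case by blast
qed

text \<open>The columns of \<open>A\<close> are a full \<open>P\<close>-orthonormal system of
  generalized eigenvectors \<open>v i\<close>, and \<open>a i = v i \<bullet> (Q *v v i)\<close> is
  positive.\<close>

lemma simultaneous_diagonalization:
  fixes P Q :: "real^'n^'n"
  assumes P: "pos_def_cov P" and Q: "pos_def_cov Q"
  obtains A :: "real^'n^'n" and a :: "'n \<Rightarrow> real" where
    "transpose A ** P ** A = mat 1"
    "transpose A ** Q ** A = (\<chi> i j. if i = j then a i else 0)"
    "\<And>i. 0 < a i"
proof -
  have Qsym: "transpose Q = Q" using Q by (simp add: pos_def_cov_def)
  obtain v :: "'n \<Rightarrow> real^'n" and a where "\<forall>i\<in>UNIV. \<forall>j\<in>UNIV. v i \<bullet> (P *v v j) = of_bool (i = j)"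
    and "\<forall>i\<in>UNIV. Q *v v i = a i *\<^sub>R (P *v v i)"
    using partial_simultaneous_diagonalization[OF P Qsym, of UNIV] by blast
  then have orth: "v i \<bullet> (P *v v j) = of_bool (i = j)" and eig: "Q *v v i = a i *\<^sub>R (P *v v i)" for i j
    by auto
  define A where "A = (\<chi> i j. v j $ i)"
  have entry: "(transpose A ** M ** A) $ i $ j = v i \<bullet> (M *v v j)" for M i j
    unfolding matrix_mul_assoc[symmetric]
    by (simp add: matrix_matrix_mult_def transpose_def A_def inner_vec_def matrix_vector_mult_def)
  have "v i \<noteq> 0" for i using orth[of i i] by auto
  then have "0 < a i" for i
    using Q orth[of i i] eig[of i] unfolding pos_def_cov_def by (metis inner_scaleR_right mult.right_neutral of_bool_eq(2))
  then show ?thesis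
    using that[of A a] by (simp add: vec_eq_iff entry orth eig mat_def)
qed

section \<open>The scalar inequality\<close>

text \<open>This is twice the divergence of the standard normal law from the centred normal law of
  precision \<open>a\<close>; \<open>kl_dev (1 / a)\<close> belongs to the opposite
  direction.\<close>

definition kl_dev :: "real \<Rightarrow> real" where
  "kl_dev a = a - 1 - ln a"

lemma kl_dev_nonneg: "0 < a \<Longrightarrow> 0 \<le> kl_dev a"
  using ln_le_minus_one[of a] by (simp add: kl_dev_def)

lemma kl_dev_1 [simp]: "kl_dev 1 = 0"
  by (simp add: kl_dev_def)

lemma kl_dev_pos: "0 < a \<Longrightarrow> a \<noteq> 1 \<Longrightarrow> 0 < kl_dev a"
  using kl_dev_nonneg[of a] ln_eq_minus_one[of a] by (force simp: kl_dev_def)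

lemma has_real_derivative_kl_dev [derivative_intros]:
  "0 < a \<Longrightarrow> (kl_dev has_real_derivative 1 - 1 / a) (at a)"
  unfolding kl_dev_def by (auto intro!: derivative_eq_intros simp: field_simps)

lemma kl_dev_antimono:
  assumes "0 < a" "a \<le> b" "b \<le> 1"
  shows "kl_dev b \<le> kl_dev a"
  by (rule DERIV_nonpos_imp_nonincreasing[OF assms(2)])
     (use assms in \<open>auto intro!: exI has_real_derivative_kl_dev simp: field_simps\<close>)

text \<open>Strictness makes \<open>kl_dev\<close> injective on \<open>(0, 1]\<close>, which gives
  uniqueness of the Lambert value and the bound \<open>w \<le> a\<close> in each coordinate.\<close>

lemma kl_dev_strict_antimono:
  assumes "0 < a" "a < b" "b \<le> 1"
  shows "kl_dev b < kl_dev a"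
proof -
  have "\<exists>z. a < z \<and> z < b \<and> kl_dev b - kl_dev a = (b - a) * (1 - 1 / z)"
    by (rule MVT2) (use assms in \<open>auto intro: has_real_derivative_kl_dev\<close>)
  then obtain z where "a < z" "z < b" "kl_dev b - kl_dev a = (b - a) * (1 - 1 / z)" by blast
  moreover have "1 - 1 / z < 0" using calculation assms by (simp add: field_simps)
  ultimately show ?thesis using assms mult_pos_neg[of "b - a" "1 - 1 / z"] by simp
qed

lemma ex_kl_dev_eq:
  assumes "0 < T"
  obtains w where "0 < w" "w < 1" "kl_dev w = T"
proof -
  \<comment> \<open>At this point \<open>- 1 - ln ?l = T\<close>, so
    \<open>kl_dev ?l = ?l + T\<close> already exceeds \<open>T\<close>.\<close>
  let ?l = "exp (- (1 + T))"
  have l: "0 < ?l" "?l < 1" using assms by auto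
  have "\<exists>w\<ge>?l. w \<le> 1 \<and> kl_dev w = T"
  proof (rule IVT2)
    show "kl_dev 1 \<le> T" using assms by simp
    show "T \<le> kl_dev ?l" by (simp add: kl_dev_def)
    show "\<forall>x. ?l \<le> x \<and> x \<le> 1 \<longrightarrow> isCont kl_dev x"
      using l has_real_derivative_kl_dev by (meson DERIV_isCont less_le_trans)
  qed (use l in auto)
  then obtain w where "?l \<le> w" "w \<le> 1" "kl_dev w = T" by blast
  moreover then have "w \<noteq> 1" using assms by auto
  ultimately show ?thesis using l that[of w] by linarith
qed

text \<open>Exponentiating the definition of \<open>kl_dev\<close> gives
  \<open>exp (- (1 + kl_dev w)) = w * exp (- w)\<close>, so \<open>- w\<close> solves the equation,
  and \<open>w < 1\<close> puts it on the principal branch. Taking logarithms of any other solution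
  \<open>v\<close> returns \<open>kl_dev (- v) = kl_dev w\<close>.\<close>

lemma LambertW0_kl_dev:
  assumes w: "0 < w" "w < 1"
  shows "LambertW0 (- exp (- (1 + kl_dev w))) = - w"
proof -
  have eq: "- w * exp (- w) = - exp (- (1 + kl_dev w))"
    using w by (simp add: kl_dev_def exp_diff exp_minus field_simps)
  show ?thesis
    unfolding LambertW0_def
  proof (rule the_equality)
    show "- 1 \<le> - w \<and> - w * exp (- w) = - exp (- (1 + kl_dev w))" using w eq by simp
    fix v assume v: "- 1 \<le> v \<and> v * exp v = - exp (- (1 + kl_dev w))"
    then have "v * exp v < 0" by simp
    then have v0: "v < 0" by (simp add: mult_less_0_iff)
    have "ln ((- v) * exp v) = ln (w * exp (- w))" using v eq by simp
    then have "kl_dev (- v) = kl_dev w"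
      using v0 w ln_mult[of "- v" "exp v"] ln_mult[of w "exp (- w)"] by (simp add: kl_dev_def)
    then show "v = - w"
      using kl_dev_strict_antimono[of w "- v"] kl_dev_strict_antimono[of "- v" w] v v0 w
      by (cases "w < - v"; cases "- v < w") auto
  qed
qed

text \<open>The case without mean shift. The difference \<open>\<phi>\<close> of the two sides,
  scaled, vanishes at \<open>w\<close> and at 1, and its derivative changes sign only at 1 and at
  \<open>1 / c\<close>. Rolle places \<open>1 / c\<close> between \<open>w\<close> and 1, so
  \<open>\<phi>\<close> rises from 0, falls back to 0 at 1 and rises again.\<close>

lemma kl_dev_inverse_ratio:
  assumes w: "0 < w" "w < 1" and a: "w \<le> a"
  shows "kl_dev (1 / a) * kl_dev w \<le> kl_dev (1 / w) * kl_dev a"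
proof -
  define c where "c = kl_dev (1 / w) / kl_dev w"
  define \<phi> where "\<phi> x = c * kl_dev x - kl_dev (1 / x)" for x
  have kw: "0 < kl_dev w" using w by (simp add: kl_dev_pos)
  have \<phi>': "(\<phi> has_real_derivative (x - 1) / x * (c - 1 / x)) (at x)" if "0 < x" for x
  proof -
    have "((\<lambda>x. c * kl_dev x - (1 / x - 1 + ln x)) has_real_derivative (x - 1) / x * (c - 1 / x)) (at x)"
      using that by (auto intro!: derivative_eq_intros simp: field_simps power2_eq_square)
    then show ?thesis
      by (rule has_field_derivative_transform_within_open[where S = "{0<..}"])
         (use that in \<open>auto simp: \<phi>_def kl_dev_def ln_div\<close>)
  qed
  have \<phi>0: "\<phi> w = 0" "\<phi> 1 = 0" using kw by (simp_all add: \<phi>_def c_def)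
  \<comment> \<open>This critical point identifies \<open>c\<close> as \<open>1 / z\<close>, which
    fixes the sign of the derivative on each of the three intervals.\<close>
  have "\<exists>z. w < z \<and> z < 1 \<and> \<phi> 1 - \<phi> w = (1 - w) * ((z - 1) / z * (c - 1 / z))"
    by (rule MVT2) (use w \<phi>' in \<open>simp_all del: times_divide_eq_left\<close>)
  then obtain z where z: "w < z" "z < 1" "(z - 1) / z * (c - 1 / z) = 0"
    using \<phi>0 w by auto
  have c: "c = 1 / z" using z w by auto
  have "0 \<le> \<phi> a"
  proof -
    consider "a \<le> z" | "z \<le> a" "a \<le> 1" | "1 \<le> a" by linarith
    then show ?thesis
    proof cases
      case 1
      have "\<phi> w \<le> \<phi> a"
      proof (rule DERIV_nonneg_imp_nondecreasing[OF a])
        fix x assume "w \<le> x" "x \<le> a"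
        then show "\<exists>y. (\<phi> has_real_derivative y) (at x) \<and> 0 \<le> y"
          using 1 w z by (intro exI[of _ "(x - 1) / x * (c - 1 / x)"] conjI \<phi>' mult_nonpos_nonpos)
            (auto simp: c field_simps)
      qed
      then show ?thesis using \<phi>0 by simp
    next
      case 2
      have "\<phi> 1 \<le> \<phi> a"
      proof (rule DERIV_nonpos_imp_nonincreasing[OF 2(2)])
        fix x assume "a \<le> x" "x \<le> 1"
        then show "\<exists>y. (\<phi> has_real_derivative y) (at x) \<and> y \<le> 0"
          using 2 w z by (intro exI[of _ "(x - 1) / x * (c - 1 / x)"] conjI \<phi>' mult_nonpos_nonneg)
            (auto simp: c field_simps)
      qed
      then show ?thesis using \<phi>0 by simp
    next
      case 3
      have "\<phi> 1 \<le> \<phi> a"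
      proof (rule DERIV_nonneg_imp_nondecreasing[OF 3])
        fix x assume "1 \<le> x" "x \<le> a"
        then show "\<exists>y. (\<phi> has_real_derivative y) (at x) \<and> 0 \<le> y"
          using w z by (intro exI[of _ "(x - 1) / x * (c - 1 / x)"] conjI \<phi>' mult_nonneg_nonneg)
            (auto simp: c field_simps)
      qed
      then show ?thesis using \<phi>0 by simp
    qed
  qed
  then show ?thesis using kw by (simp add: \<phi>_def c_def field_simps)
qed

text \<open>The case where the mean shift uses up all that \<open>kl_dev a\<close> leaves of
  \<open>kl_dev w\<close>. As a function of \<open>a\<close> the left side has derivative
  \<open>(kl_dev a - kl_dev w) / a\<^sup>2\<close>, which is nonpositive on the range, and at
  \<open>w\<close> it equals the right side.\<close>

lemma kl_dev_inverse_shift: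
  assumes w: "0 < w" "w < 1" and a: "w \<le> a" "kl_dev a \<le> kl_dev w"
  shows "kl_dev (1 / a) + (kl_dev w - kl_dev a) / a \<le> kl_dev (1 / w)"
proof -
  define h where "h x = kl_dev (1 / x) + (kl_dev w - kl_dev x) / x" for x
  have h': "(h has_real_derivative (kl_dev x - kl_dev w) / x\<^sup>2) (at x)" if "0 < x" for x
  proof -
    have "((\<lambda>x. (1 / x - 1 + ln x) + (kl_dev w - kl_dev x) / x) has_real_derivative (kl_dev x - kl_dev w) / x\<^sup>2) (at x)"
      using that by (auto intro!: derivative_eq_intros simp: field_simps power2_eq_square)
    then show ?thesis
      by (rule has_field_derivative_transform_within_open[where S = "{0<..}"])
         (use that in \<open>auto simp: h_def kl_dev_def ln_div\<close>)
  qed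
  \<comment> \<open>\<open>kl_dev\<close> falls up to 1 and rises afterwards, so on
    \<open>[w, a]\<close> it is largest at an endpoint.\<close>
  have le: "kl_dev x \<le> kl_dev w" if x: "w \<le> x" "x \<le> a" for x
  proof (cases "x \<le> 1")
    case True
    then show ?thesis using kl_dev_antimono[of w x] w x by simp
  next
    case False
    have "kl_dev x \<le> kl_dev a"
      by (rule DERIV_nonneg_imp_nondecreasing[OF x(2)])
         (use False in \<open>auto intro!: exI has_real_derivative_kl_dev simp: field_simps\<close>)
    then show ?thesis using a by simp
  qed
  have "h a \<le> h w"
  proof (rule DERIV_nonpos_imp_nonincreasing[OF a(1)])
    fix x assume x: "w \<le> x" "x \<le> a"
    then show "\<exists>y. (h has_real_derivative y) (at x) \<and> y \<le> 0"
      using w le[OF x] h'[of x] by (intro exI conjI) (auto simp: divide_nonpos_nonneg)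
  qed
  then show ?thesis by (simp add: h_def)
qed

text \<open>Both sides are affine in \<open>M\<close>, so it suffices to check the two extreme values
  \<open>M = 0\<close> and \<open>M = (kl_dev w - kl_dev a) / a\<close>.\<close>
lemma kl_dev_coordinate_bound:
  assumes w: "0 < w" "w < 1" and a: "0 < a" and M: "0 \<le> M" and le: "kl_dev a + a * M \<le> kl_dev w"
  shows "kl_dev (1 / a) + M \<le> kl_dev (1 / w) / kl_dev w * (kl_dev a + a * M)"
proof -
  have aM: "0 \<le> a * M" using a M by simp
  have kw: "0 < kl_dev w" using w by (simp add: kl_dev_pos)
  have aw: "w \<le> a"
    using kl_dev_strict_antimono[of a w] le aM a w by linarith
  define c where "c = kl_dev (1 / w) / kl_dev w"
  have c: "kl_dev (1 / w) = c * kl_dev w" using kw by (simp add: c_def)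
  define D where "D = kl_dev w - kl_dev a"
  have D: "a * M \<le> D" using le by (simp add: D_def)
  have 1: "kl_dev (1 / a) \<le> c * kl_dev a"
    using kl_dev_inverse_ratio[OF w aw] kw by (simp add: c_def field_simps)
  have 2: "kl_dev (1 / a) + D / a \<le> c * (kl_dev a + D)"
    using kl_dev_inverse_shift[OF w aw] le aM by (simp add: c D_def)
  show ?thesis
  \<comment> \<open>If \<open>D = 0\<close> there is no room for a shift; otherwise \<open>M\<close>
    is the convex combination of 0 and \<open>D / a\<close> with weight \<open>t\<close>.\<close>
  proof (cases "D = 0")
    case True
    then have "M = 0" using D M a by (simp add: mult_le_0_iff)
    then show ?thesis using 1 by (simp add: c_def)
  next
    case False
    define t where "t = a * M / D"
    have D0: "0 < D" using False D aM by linarith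
    have t: "0 \<le> t" "t \<le> 1" "a * M = t * D" using D0 D aM by (auto simp: t_def)
    have "M = t * (D / a)" using t(3) a by (simp add: field_simps)
    then have "kl_dev (1 / a) + M = (1 - t) * kl_dev (1 / a) + t * (kl_dev (1 / a) + D / a)"
      by (simp add: algebra_simps)
    also have "\<dots> \<le> (1 - t) * (c * kl_dev a) + t * (c * (kl_dev a + D))"
      using t 1 2 by (intro add_mono mult_left_mono) auto
    also have "\<dots> = c * (kl_dev a + a * M)" by (simp only: t(3)) (simp add: algebra_simps)
    finally show ?thesis by (simp add: c_def)
  qed
qed

text \<open>Nonnegativity keeps each summand below \<open>kl_dev w\<close>, so the coordinate bound
  applies to each. Its slope is the same for all coordinates, so the bounds add up to one
  independent of the dimension.\<close>

lemma kl_dev_sum_bound: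
  fixes a M :: "'i \<Rightarrow> real"
  assumes "finite I" and w: "0 < w" "w < 1"
    and a: "\<And>i. i \<in> I \<Longrightarrow> 0 < a i" and M: "\<And>i. i \<in> I \<Longrightarrow> 0 \<le> M i"
    and le: "(\<Sum>i\<in>I. kl_dev (a i) + a i * M i) \<le> kl_dev w"
  shows "(\<Sum>i\<in>I. kl_dev (1 / a i) + M i) \<le> kl_dev (1 / w)"
proof -
  have kw: "0 < kl_dev w" using w by (simp add: kl_dev_pos)
  have nonneg: "0 \<le> kl_dev (a i) + a i * M i" if "i \<in> I" for i
    using a[OF that] M[OF that] kl_dev_nonneg by simp
  have "kl_dev (a i) + a i * M i \<le> kl_dev w" if "i \<in> I" for i
    using member_le_sum[OF that, of "\<lambda>i. kl_dev (a i) + a i * M i"] nonneg \<open>finite I\<close> le by force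
  then have "(\<Sum>i\<in>I. kl_dev (1 / a i) + M i)
      \<le> (\<Sum>i\<in>I. kl_dev (1 / w) / kl_dev w * (kl_dev (a i) + a i * M i))"
    using w a M by (intro sum_mono kl_dev_coordinate_bound) auto
  also have "\<dots> = kl_dev (1 / w) / kl_dev w * (\<Sum>i\<in>I. kl_dev (a i) + a i * M i)"
    by (simp add: sum_distrib_left)
  also have "\<dots> \<le> kl_dev (1 / w) / kl_dev w * kl_dev w"
    using le kw kl_dev_nonneg[of "1 / w"] w by (intro mult_left_mono) auto
  finally show ?thesis using kw by simp
qed

section \<open>Divergence of Gaussians\<close>

lemma borel_measurable_gauss_density [measurable]:
  "gauss_density mu S \<in> borel_measurable borel"
proof -
  have [measurable]: "(\<lambda>x. (x - mu) \<bullet> (matrix_inv S *v (x - mu))) \<in> borel_measurable borel"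
    by (intro borel_measurable_continuous_onI continuous_intros
        continuous_on_compose2[OF matrix_vector_mult_linear_continuous_on[of UNIV]]) auto
  show ?thesis unfolding gauss_density_def[abs_def] by measurable
qed

text \<open>The substitution \<open>x = mu1 + A *v y\<close> makes the first density a product of
  standard normal ones and the log ratio a sum of quadratics \<open>?g i\<close> in single
  coordinates, so the divergence is a sum of one-dimensional expectations.\<close>

lemma KL_gauss_diagonal:
  fixes A S1 S2 :: "real^'n^'n" and a :: "'n \<Rightarrow> real" and m mu1 mu2 :: "real^'n"
  assumes detA: "det A \<noteq> 0"
    and det1: "det S1 = (det A)\<^sup>2" and det2: "det S2 * (\<Prod>i\<in>UNIV. a i) = (det A)\<^sup>2"
    and quad1: "\<And>y. (A *v y) \<bullet> (matrix_inv S1 *v (A *v y)) = (\<Sum>i\<in>UNIV. (y $ i)\<^sup>2)"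
    and quad2: "\<And>y. (A *v y) \<bullet> (matrix_inv S2 *v (A *v y)) = (\<Sum>i\<in>UNIV. a i * (y $ i)\<^sup>2)"
    and a: "\<And>i. 0 < a i" and m: "mu2 = mu1 + A *v m"
  shows "KL_gauss mu1 S1 mu2 S2 = (\<Sum>i\<in>UNIV. kl_dev (a i) + a i * (m $ i)\<^sup>2) / 2"
proof -
  let ?p = "gauss_density mu1 S1" and ?q = "gauss_density mu2 S2"
  let ?x = "\<lambda>y. mu1 + A *v y"
  let ?g = "\<lambda>i t. (a i * (t - m $ i)\<^sup>2 - t\<^sup>2 - ln (a i)) / 2"
  have pa: "0 < (\<Prod>i\<in>UNIV. a i)" using a by (simp add: prod_pos)
  have d1: "0 < det S1" using detA by (simp add: det1)
  have d2: "0 < det S2" using det2 pa detA by (metis zero_less_mult_pos2 zero_less_power2)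
  have p: "?p (?x y) = exp (- (\<Sum>i\<in>UNIV. (y $ i)\<^sup>2) / 2) / sqrt ((2 * pi) ^ CARD('n) * det S1)" for y
    by (simp add: gauss_density_def quad1)
  have p_std: "\<bar>det A\<bar> * ?p (?x y) = (\<Prod>i\<in>UNIV. std_normal_density (y $ i))" for y
  proof -
    have "(\<Prod>i\<in>UNIV. std_normal_density (y $ i)) = (1 / sqrt (2 * pi)) ^ CARD('n) * exp (\<Sum>i\<in>UNIV. - (y $ i)\<^sup>2 / 2)"
      by (simp add: std_normal_density_def prod.distrib exp_sum prod_dividef power_one_over)
    moreover have "(\<Sum>i\<in>UNIV. - (y $ i)\<^sup>2 / 2) = - (\<Sum>i\<in>UNIV. (y $ i)\<^sup>2) / 2"
      by (simp add: sum_negf sum_divide_distrib)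
    moreover have "sqrt ((2 * pi) ^ CARD('n) * det S1) = sqrt (2 * pi) ^ CARD('n) * \<bar>det A\<bar>"
      by (simp only: det1 real_sqrt_mult[of "_ ^ _"] real_sqrt_power[of "2 * pi"] real_sqrt_abs)
    ultimately show ?thesis
      unfolding p using detA by (simp add: power_one_over)
  qed
  have q: "?q (?x y) = exp (- (\<Sum>i\<in>UNIV. a i * (y $ i - m $ i)\<^sup>2) / 2) / sqrt ((2 * pi) ^ CARD('n) * det S2)" for y
  proof -
    have "?x y - mu2 = A *v (y - m)" by (simp add: m matrix_vector_mult_diff_distrib)
    then show ?thesis by (simp add: gauss_density_def quad2)
  qed
  have ln_pq: "ln (?p (?x y) / ?q (?x y)) = (\<Sum>i\<in>UNIV. ?g i (y $ i))" for y
  proof -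
    have "ln (?p (?x y) / ?q (?x y)) = ((\<Sum>i\<in>UNIV. a i * (y $ i - m $ i)\<^sup>2) - (\<Sum>i\<in>UNIV. (y $ i)\<^sup>2)
        + ln (det S2) - ln (det S1)) / 2"
      using d1 d2 by (simp add: p q ln_div ln_mult ln_sqrt field_simps)
    \<comment> \<open>The normalising constants contribute the terms
      \<open>- ln (a i)\<close>.\<close>
    also have "ln (det S1) = ln (det S2) + (\<Sum>i\<in>UNIV. ln (a i))"
    proof -
      have "ln (\<Prod>i\<in>UNIV. a i) = (\<Sum>i\<in>UNIV. ln (a i))"
        by (rule ln_prod) (use a in \<open>simp_all add: less_imp_neq[symmetric]\<close>)
      moreover have "det S1 = det S2 * (\<Prod>i\<in>UNIV. a i)" using det1 det2 by simp
      ultimately show ?thesis using d2 pa by (simp only: ln_mult_pos)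
    qed
    finally show ?thesis
      by (simp add: sum_subtractf flip: sum_divide_distrib)
  qed
  have std: "\<bar>det A\<bar> * (?p (?x y) * ln (?p (?x y) / ?q (?x y)))
      = (\<Sum>k\<in>UNIV. (\<Prod>i\<in>UNIV. std_normal_density (y $ i)) * ?g k (y $ k))" for y
    unfolding mult.assoc[symmetric] p_std ln_pq by (rule sum_distrib_left)
  have "has_bochner_integral lborel (\<lambda>t. std_normal_density t * ?g k t)
      ((kl_dev (a k) + a k * (m $ k)\<^sup>2) / 2)" for k
  proof -
    \<comment> \<open>Only the quadratic and constant coefficients survive integration against the
      standard normal density.\<close>
    have "?g k t = (a k - 1) / 2 * t\<^sup>2 + (- a k * m $ k) * t + (a k * (m $ k)\<^sup>2 - ln (a k)) / 2" for t
      by (simp add: field_simps power2_eq_square)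
    moreover have "(kl_dev (a k) + a k * (m $ k)\<^sup>2) / 2 = (a k - 1) / 2 + (a k * (m $ k)\<^sup>2 - ln (a k)) / 2"
      by (simp add: kl_dev_def field_simps)
    ultimately show ?thesis
      by (simp only: has_bochner_integral_std_normal_quadratic)
  qed
  then have "has_bochner_integral lborel
      (\<lambda>y::real^'n. \<Sum>k\<in>UNIV. (\<Prod>i\<in>UNIV. std_normal_density (y $ i)) * ?g k (y $ k))
      (\<Sum>k\<in>UNIV. (kl_dev (a k) + a k * (m $ k)\<^sup>2) / 2)"
    by (intro has_bochner_integral_sum has_bochner_integral_std_normal_marginal) auto
  moreover have "KL_gauss mu1 S1 mu2 S2 = (\<integral>y. \<bar>det A\<bar> * (?p (?x y) * ln (?p (?x y) / ?q (?x y))) \<partial>lborel)"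
    unfolding KL_gauss_def KL_dens_def
    by (rule integral_lborel_affine_matrix[OF detA]) measurable
  ultimately show ?thesis
    unfolding std by (simp add: has_bochner_integral_iff sum_divide_distrib)
qed

lemma quadratic_form_diagonal:
  fixes A P :: "real^'n^'n"
  assumes "transpose A ** P ** A = (\<chi> i j. if i = j then a i else 0)"
  shows "(A *v y) \<bullet> (P *v (A *v y)) = (\<Sum>i\<in>UNIV. a i * (y $ i)\<^sup>2)"
proof -
  have "(A *v y) \<bullet> (P *v (A *v y)) = y \<bullet> ((transpose A ** P ** A) *v y)"
    by (metis dot_lmul_matrix inner_commute matrix_vector_mul_assoc transpose_matrix_vector)
  moreover have "((transpose A ** P ** A) *v y) $ i = a i * y $ i" for i
    unfolding assms
    by (simp add: matrix_vector_mult_def if_distrib[of "\<lambda>u. u * v" for v] cong: if_cong)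
  ultimately show ?thesis
    by (simp add: inner_vec_def power2_eq_square mult_ac)
qed

lemma det_congruence_diagonal:
  fixes A S :: "real^'n^'n"
  assumes "invertible S" and "transpose A ** matrix_inv S ** A = (\<chi> i j. if i = j then a i else 0)"
  shows "det S * (\<Prod>i\<in>UNIV. a i) = (det A)\<^sup>2"
proof -
  have "det A * det (matrix_inv S) * det A = (\<Prod>i\<in>UNIV. a i)"
    using arg_cong[OF assms(2), of det] by (simp add: det_mul det_transpose det_diagonal)
  moreover have "det S * det (matrix_inv S) = 1"
    using matrix_inv_mult(1)[OF assms(1)] by (metis det_I det_mul)
  ultimately show ?thesis
    by (metis (no_types, lifting) mult.assoc mult.commute mult_1 power2_eq_square)
qed

text \<open>The inverse covariances are diagonalized because they are what the exponents contain.
  One congruence serves both directions: rescaling it by \<open>D\<close> makes the second Gaussian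
  the standard one.\<close>

lemma KL_gauss_simultaneous:
  fixes S1 S2 :: "real^'n^'n" and mu1 mu2 :: "real^'n"
  assumes S1: "pos_def_cov S1" and S2: "pos_def_cov S2"
  obtains a M :: "'n \<Rightarrow> real" where
    "\<And>i. 0 < a i" "\<And>i. 0 \<le> M i"
    "KL_gauss mu1 S1 mu2 S2 = (\<Sum>i\<in>UNIV. kl_dev (a i) + a i * M i) / 2"
    "KL_gauss mu2 S2 mu1 S1 = (\<Sum>i\<in>UNIV. kl_dev (1 / a i) + M i) / 2"
proof -
  obtain A :: "real^'n^'n" and a :: "'n \<Rightarrow> real" where A1: "transpose A ** matrix_inv S1 ** A = mat 1"
    and A2: "transpose A ** matrix_inv S2 ** A = (\<chi> i j. if i = j then a i else 0)"
    and a: "\<And>i. 0 < a i"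
    using simultaneous_diagonalization[OF pos_def_cov_matrix_inv[OF S1] pos_def_cov_matrix_inv[OF S2]]
    by blast
  have a_ne: "a i \<noteq> 0" for i using a[of i] by simp
  have A1': "transpose A ** matrix_inv S1 ** A = (\<chi> i j. if i = j then (\<lambda>_. 1) i else 0)"
    using A1 by (simp add: mat_def)
  note inv = pos_def_cov_imp_invertible[OF S1] pos_def_cov_imp_invertible[OF S2]
  have det1: "det S1 = (det A)\<^sup>2" using det_congruence_diagonal[OF inv(1) A1'] by simp
  have det2: "det S2 * (\<Prod>i\<in>UNIV. a i) = (det A)\<^sup>2" using det_congruence_diagonal[OF inv(2) A2] .
  have detA: "det A \<noteq> 0" using inv(1) det1 by (auto simp: invertible_det_nz)
  have quad1: "(A *v y) \<bullet> (matrix_inv S1 *v (A *v y)) = (\<Sum>i\<in>UNIV. (y $ i)\<^sup>2)" for y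
    using quadratic_form_diagonal[OF A1'] by simp
  have quad2: "(A *v y) \<bullet> (matrix_inv S2 *v (A *v y)) = (\<Sum>i\<in>UNIV. a i * (y $ i)\<^sup>2)" for y
    using quadratic_form_diagonal[OF A2] .
  define m where "m = matrix_inv A *v (mu2 - mu1)"
  have m: "mu2 = mu1 + A *v m"
    using matrix_inv_mult(1)[of A] detA by (simp add: m_def matrix_vector_mul_assoc invertible_det_nz)
  have KL12: "KL_gauss mu1 S1 mu2 S2 = (\<Sum>i\<in>UNIV. kl_dev (a i) + a i * (m $ i)\<^sup>2) / 2"
    by (rule KL_gauss_diagonal[OF detA det1 det2 quad1 quad2 a m])
  \<comment> \<open>This normalises the precisions \<open>a i\<close> of \<open>S2\<close> to 1 and
    turns those of \<open>S1\<close> into \<open>1 / a i\<close>.\<close>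
  define D :: "real^'n^'n" where "D = (\<chi> i j. if i = j then 1 / sqrt (a i) else 0)"
  define A' where "A' = A ** D"
  \<comment> \<open>The reversed mean difference in the rescaled coordinates; the weight
    \<open>1 / a i\<close> then cancels against its square, leaving
    \<open>(m $ i)\<^sup>2\<close>.\<close>
  define m' :: "real^'n" where "m' = (\<chi> i. - sqrt (a i) * m $ i)"
  have D: "(D *v y) $ i = y $ i / sqrt (a i)" for y i
    by (simp add: D_def matrix_vector_mult_def if_distrib[of "\<lambda>u. u * v" for v] cong: if_cong)
  have A'v: "A' *v y = A *v (D *v y)" for y
    by (simp add: A'_def matrix_vector_mul_assoc)
  have "det D = (\<Prod>i\<in>UNIV. 1 / sqrt (a i))"
    by (simp add: D_def det_diagonal)
  then have "(det D)\<^sup>2 = (\<Prod>i\<in>UNIV. (1 / sqrt (a i))\<^sup>2)"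
    by (simp only: prod_power_distrib)
  then have "(det D)\<^sup>2 = (\<Prod>i\<in>UNIV. 1 / a i)"
    using a by (simp add: power_divide less_imp_le)
  then have detA'2: "(det A')\<^sup>2 = (det A)\<^sup>2 * (\<Prod>i\<in>UNIV. 1 / a i)"
    by (simp add: A'_def det_mul power_mult_distrib)
  have pinv: "(\<Prod>i\<in>UNIV. a i) * (\<Prod>i\<in>UNIV. 1 / a i) = 1"
    using a by (simp add: prod.distrib[symmetric] a_ne)
  have "KL_gauss mu2 S2 mu1 S1 = (\<Sum>i\<in>UNIV. kl_dev (1 / a i) + 1 / a i * (m' $ i)\<^sup>2) / 2"
  proof (rule KL_gauss_diagonal)
    show "det A' \<noteq> 0" using detA'2 detA a_ne by auto
    show "det S2 = (det A')\<^sup>2"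
      unfolding detA'2 det2[symmetric] using pinv by (simp add: mult.assoc)
    show "det S1 * (\<Prod>i\<in>UNIV. 1 / a i) = (det A')\<^sup>2"
      unfolding detA'2 det1 ..
    show "(A' *v y) \<bullet> (matrix_inv S2 *v (A' *v y)) = (\<Sum>i\<in>UNIV. (y $ i)\<^sup>2)" for y
      using a unfolding A'v quad2 D by (simp add: power_divide less_imp_le a_ne)
    show "(A' *v y) \<bullet> (matrix_inv S1 *v (A' *v y)) = (\<Sum>i\<in>UNIV. 1 / a i * (y $ i)\<^sup>2)" for y
      using a unfolding A'v quad1 D by (simp add: power_divide less_imp_le)
    show "0 < 1 / a i" for i using a by simp
    have "D *v m' = - m"
      using a by (simp add: vec_eq_iff D m'_def a_ne)
    then show "mu1 = mu2 + A' *v m'" by (simp add: A'v m linear_neg[OF matrix_vector_mul_linear])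
  qed
  moreover have "1 / a i * (m' $ i)\<^sup>2 = (m $ i)\<^sup>2" for i
    using a by (simp add: m'_def power_mult_distrib less_imp_le a_ne)
  ultimately have "KL_gauss mu2 S2 mu1 S1 = (\<Sum>i\<in>UNIV. kl_dev (1 / a i) + (m $ i)\<^sup>2) / 2"
    by (simp only:)
  with a KL12 show ?thesis
    by (intro that[of a "\<lambda>i. (m $ i)\<^sup>2"]) auto
qed

theorem theorem2:
  fixes eps :: real and mu1 mu2 :: "real^'n" and S1 S2 :: "real^'n^'n"
  assumes "eps > 0"
    and "pos_def_cov S1" and "pos_def_cov S2"
    and "KL_gauss mu1 S1 mu2 S2 \<le> eps"
  shows "KL_gauss mu2 S2 mu1 S1 \<le>
    (let w = - LambertW0 (- exp (- (1 + 2 * eps))) in (1 / w - ln (1 / w) - 1) / 2)"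
proof -
  \<comment> \<open>The factor 2 clears the halves in both divergences; likewise
    \<open>kl_dev (1 / w)\<close> is twice the claimed bound.\<close>
  obtain w where w: "0 < w" "w < 1" "kl_dev w = 2 * eps"
    using ex_kl_dev_eq[of "2 * eps"] \<open>eps > 0\<close> by auto
  obtain a M :: "'n \<Rightarrow> real" where aM: "\<And>i. 0 < a i" "\<And>i. 0 \<le> M i"
    and KL12: "KL_gauss mu1 S1 mu2 S2 = (\<Sum>i\<in>UNIV. kl_dev (a i) + a i * M i) / 2"
    and KL21: "KL_gauss mu2 S2 mu1 S1 = (\<Sum>i\<in>UNIV. kl_dev (1 / a i) + M i) / 2"
    using KL_gauss_simultaneous[OF assms(2,3)] by blast
  have "(\<Sum>i\<in>UNIV. kl_dev (1 / a i) + M i) \<le> kl_dev (1 / w)"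
    using w aM assms(4) KL12 by (intro kl_dev_sum_bound) auto
  moreover have "LambertW0 (- exp (- (1 + 2 * eps))) = - w"
    using LambertW0_kl_dev[OF w(1,2)] w(3) by simp
  ultimately show ?thesis
    unfolding KL21 by (simp add: kl_dev_def)
qed

end
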